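(* Let $\mathbf P_1,\mathbf P_2$ be known symmetric $d\times d$ edge intensity matrices with positive entries, and let a network $\mathbf X$ be sampled from $\mathbf P_1$, i.e. $\mathbf X(\omega)\sim\mathrm{Poisson}(\mathbf P_1(\omega))$ independently for $\omega\in\mathcal J_d$. Then the probability of mis-clustering $\mathbf X$ by the likelihood-based Lloyd's algorithm satisfies $$\mathbb P(\mathbf X\text{ is mis-clustered})\le\exp(-I^{*}/2),\qquad I^{*}=\sum_{\omega\in\mathcal J_d}\Big(\sqrt{\mathbf P_1(\omega)}-\sqrt{\mathbf P_2(\omega)}\Big)^2.$$ Similarly, the same bound holds if $\mathbf X$ is sampled from $\mathbf P_2$.
   Context: $\mathcal J_d=\{(j_1,j_2):1\le j_1\le j_2\le d\}$. The log-likelihood is $\ell(\mathbf X|z)=\sum_{\omega\in\mathcal J_d}\big(-\mathbf P_z(\omega)+\mathbf X(\omega)\log\mathbf P_z(\omega)-\log(\mathbf X(\omega)!)\big)$, $z\in[2]$. The likelihood-based Lloyd's algorithm assigns to $\mathbf X$ the label maximizing $\ell(\mathbf X|z)$. When the true label is $1$, $\mathbf X$ is mis-clustered if $$\sum_{\omega\in\mathcal J_d}(\mathbf P_1(\omega)-\mathbf P_2(\omega))>\sum_{\omega\in\mathcal J_d}\mathbf X(\omega)\log\frac{\mathbf P_1(\omega)}{\mathbf P_2(\omega)},$$ i.e. $\ell(\mathbf X|2)>\ell(\mathbf X|1)$; when the true label is $2$ the roles of $1,2$ are swapped. *)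

theory Defs
  imports "HOL-Probability.Probability"
begin

(* A d \<times> d matrix is a function on pairs of indices; only the entries with
   indices in {1..d} are meaningful. *)

definition upper_pairs :: "nat \<Rightarrow> (nat \<times> nat) set" where
  "upper_pairs d = {(j1, j2). 1 \<le> j1 \<and> j1 \<le> j2 \<and> j2 \<le> d}"

definition intensity_matrix :: "nat \<Rightarrow> (nat \<times> nat \<Rightarrow> real) \<Rightarrow> bool" where
  "intensity_matrix d P \<longleftrightarrow>
     (\<forall>i\<in>{1..d}. \<forall>j\<in>{1..d}. P (i, j) = P (j, i) \<and> P (i, j) > 0)"

definition log_likelihood ::
  "nat \<Rightarrow> (nat \<times> nat \<Rightarrow> real) \<Rightarrow> (nat \<times> nat \<Rightarrow> nat) \<Rightarrow> real" where
  "log_likelihood d P x =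
     (\<Sum>\<omega>\<in>upper_pairs d. - P \<omega> + real (x \<omega>) * ln (P \<omega>) - ln (fact (x \<omega>)))"

(* The labels the likelihood-based Lloyd step may assign: the maximizers of the
   log-likelihood over the two clusters. *)

definition lloyd_labels ::
  "nat \<Rightarrow> (nat \<Rightarrow> nat \<times> nat \<Rightarrow> real) \<Rightarrow> (nat \<times> nat \<Rightarrow> nat) \<Rightarrow> nat set" where
  "lloyd_labels d P x =
     {z. is_arg_max (\<lambda>z. log_likelihood d (P z) x) (\<lambda>z. z \<in> {1, 2}) z}"

(* A tie between the two likelihoods does not count as mis-clustering. *)

definition mis_clustered ::
  "nat \<Rightarrow> (nat \<Rightarrow> nat \<times> nat \<Rightarrow> real) \<Rightarrow> nat \<Rightarrow> (nat \<times> nat \<Rightarrow> nat) \<Rightarrow> bool" where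
  "mis_clustered d P z x \<longleftrightarrow> z \<notin> lloyd_labels d P x"

definition sampled_from ::
  "'a measure \<Rightarrow> nat \<Rightarrow> (nat \<times> nat \<Rightarrow> real) \<Rightarrow> ('a \<Rightarrow> nat \<times> nat \<Rightarrow> nat) \<Rightarrow> bool" where
  "sampled_from M d P X \<longleftrightarrow>
     prob_space.indep_vars M (\<lambda>_. count_space UNIV) (\<lambda>\<omega> s. X s \<omega>) (upper_pairs d) \<and>
     (\<forall>\<omega>\<in>upper_pairs d.
        distr M (count_space UNIV) (\<lambda>s. X s \<omega>) = measure_pmf (poisson_pmf (P \<omega>)))"

definition separation :: "nat \<Rightarrow> (nat \<times> nat \<Rightarrow> real) \<Rightarrow> (nat \<times> nat \<Rightarrow> real) \<Rightarrow> real" where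
  "separation d P Q = (\<Sum>\<omega>\<in>upper_pairs d. (sqrt (P \<omega>) - sqrt (Q \<omega>))\<^sup>2)"

(* The equivalent explicit form of mis-clustering; z is the true label and z' the
   other one. *)

lemma mis_clustered_iff:
  assumes "intensity_matrix d (P 1)" "intensity_matrix d (P 2)"
    and "(z = 1 \<and> z' = 2) \<or> (z = 2 \<and> z' = (1::nat))"
  shows "mis_clustered d P z x \<longleftrightarrow>
    (\<Sum>\<omega>\<in>upper_pairs d. P z \<omega> - P z' \<omega>) >
    (\<Sum>\<omega>\<in>upper_pairs d. real (x \<omega>) * ln (P z \<omega> / P z' \<omega>))"
proof -
  have pos: "P z \<omega> > 0 \<and> P z' \<omega> > 0" if "\<omega> \<in> upper_pairs d" for \<omega>
    using assms that by (auto simp: intensity_matrix_def upper_pairs_def)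
  have "mis_clustered d P z x \<longleftrightarrow> log_likelihood d (P z') x > log_likelihood d (P z) x"
    using assms(3) by (auto simp: mis_clustered_def lloyd_labels_def is_arg_max_def)
  moreover have "log_likelihood d (P z') x - log_likelihood d (P z) x =
     (\<Sum>\<omega>\<in>upper_pairs d. P z \<omega> - P z' \<omega>) -
     (\<Sum>\<omega>\<in>upper_pairs d. real (x \<omega>) * ln (P z \<omega> / P z' \<omega>))"
    unfolding log_likelihood_def sum_subtractf[symmetric]
  proof (rule sum.cong)
    fix \<omega> assume "\<omega> \<in> upper_pairs d"
    then have "P z \<omega> > 0" "P z' \<omega> > 0" using pos by auto
    then show "- P z' \<omega> + real (x \<omega>) * ln (P z' \<omega>) - ln (fact (x \<omega>))
        - (- P z \<omega> + real (x \<omega>) * ln (P z \<omega>) - ln (fact (x \<omega>))) =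
        P z \<omega> - P z' \<omega> - real (x \<omega>) * ln (P z \<omega> / P z' \<omega>)"
      by (simp add: ln_div algebra_simps)
  qed simp
  ultimately show ?thesis
    by linarith
qed

end

theory Submission
  imports Defs
begin

text \<open>Chernoff's bound with exponent one half: on the mis-clustering event the square root of
  the likelihood ratio is at least 1, and its expectation is the Hellinger affinity of the
  two product-Poisson laws, which equals the claimed bound.\<close>

text \<open>This is the probability generating function of the Poisson law, obtained by summing the
  exponential series at \<open>p * r\<close>. Working in \<open>ennreal\<close> avoids integrability
  questions.\<close>

lemma nn_integral_poisson_power:
  assumes "p > 0" "r \<ge> 0"
  shows "(\<integral>\<^sup>+k. ennreal (r ^ k) \<partial>measure_pmf (poisson_pmf p)) = ennreal (exp (p * (r - 1)))"
proof -
  have "(\<integral>\<^sup>+k. ennreal (r ^ k) \<partial>measure_pmf (poisson_pmf p)) =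
      (\<Sum>k. ennreal ((p * r) ^ k /\<^sub>R fact k * exp (- p)))"
    using assms
    by (simp add: nn_integral_measure_pmf nn_integral_count_space_nat flip: ennreal_mult)
       (simp add: field_simps)
  also have "\<dots> = ennreal (exp (p * r) * exp (- p))"
    using assms by (intro suminf_ennreal_eq sums_mult2 exp_converges) simp
  also have "exp (p * r) * exp (- p) = exp (p * (r - 1))"
    by (simp add: algebra_simps flip: exp_add)
  finally show ?thesis .
qed

text \<open>The ratio of the Poisson weights with means \<open>q\<close> and \<open>p\<close> at
  \<open>k\<close> is exp(p - q) * (q / p)^k, because the factorials cancel. The integrand is its
  square root, so the generating function is evaluated at \<open>r = sqrt (q / p)\<close>.\<close>

lemma poisson_affinity:
  assumes "p > 0" "q > 0"
  shows "(\<integral>\<^sup>+k. ennreal (exp ((p - q) / 2) * sqrt (q / p) ^ k) \<partial>measure_pmf (poisson_pmf p)) =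
    ennreal (exp (- (sqrt p - sqrt q)\<^sup>2 / 2))"
proof -
  \<comment> \<open>Since \<open>p * sqrt (q / p)\<close> is the geometric mean of \<open>p\<close>
    and \<open>q\<close>, the left side is that mean minus the arithmetic mean, which is minus half
    a square.\<close>
  have "(p - q) / 2 + p * (sqrt (q / p) - 1) = - (sqrt p - sqrt q)\<^sup>2 / 2"
  proof -
    have "p * sqrt (q / p) = sqrt p * sqrt q"
      using assms by (simp add: real_sqrt_divide field_simps flip: power2_eq_square)
    then show ?thesis
      using assms by (simp add: power2_diff field_simps)
  qed
  then show ?thesis
    using assms
    by (simp add: ennreal_mult nn_integral_cmult nn_integral_poisson_power del: real_sqrt_divide)
       (simp flip: ennreal_mult exp_add)
qed

lemma finite_upper_pairs: "finite (upper_pairs d)"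
  by (rule finite_subset[of _ "{1..d} \<times> {1..d}"]) (auto simp: upper_pairs_def)

lemma separation_commute: "separation d P Q = separation d Q P"
  by (simp add: separation_def power2_commute)

text \<open>Keeping the true label \<open>z\<close> and the rival \<open>z'\<close> symbolic settles
  both sampling cases with one argument.\<close>

lemma mis_clustered_bound:
  assumes "prob_space M" "intensity_matrix d (P 1)" "intensity_matrix d (P 2)"
    and zz': "(z = 1 \<and> z' = 2) \<or> (z = 2 \<and> z' = (1::nat))"
    and sampled: "sampled_from M d (P z) X"
  shows "measure M {s \<in> space M. mis_clustered d P z (X s)}
    \<le> exp (- separation d (P z) (P z') / 2)"
proof -
  interpret prob_space M by fact
  let ?U = "upper_pairs d"
  \<comment> \<open>\<open>g \<omega> k\<close> is the square root of the likelihood ratio of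
    \<open>z'\<close> against \<open>z\<close> for the single entry \<omega> with count
    \<open>k\<close>.\<close>
  define g where "g \<omega> k = exp ((P z \<omega> - P z' \<omega>) / 2) * sqrt (P z' \<omega> / P z \<omega>) ^ k"
    for \<omega> and k :: nat
  have pos: "P z \<omega> > 0" "P z' \<omega> > 0" if "\<omega> \<in> ?U" for \<omega>
    using assms that by (auto simp: intensity_matrix_def upper_pairs_def)
  have indep: "indep_vars (\<lambda>_. count_space UNIV) (\<lambda>\<omega> s. X s \<omega>) ?U"
    and law: "\<omega> \<in> ?U \<Longrightarrow>
      distr M (count_space UNIV) (\<lambda>s. X s \<omega>) = measure_pmf (poisson_pmf (P z \<omega>))" for \<omega>
    using sampled by (auto simp: sampled_from_def)
  have rv: "(\<lambda>s. X s \<omega>) \<in> M \<rightarrow>\<^sub>M count_space UNIV" if "\<omega> \<in> ?U" for \<omega>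
    using indep that by (auto simp: indep_vars_def)
  have g_meas: "(\<lambda>s. ennreal (g \<omega> (X s \<omega>))) \<in> borel_measurable M" if "\<omega> \<in> ?U" for \<omega>
    by (rule measurable_compose[OF rv[OF that]]) simp
  have g_nonneg: "0 \<le> g \<omega> k" if "\<omega> \<in> ?U" for \<omega> k
    using pos[OF that] by (simp add: g_def)
  \<comment> \<open>In exponential form the product of the factors becomes exp of half the
    log-likelihood difference, which is positive when \<open>X s\<close> is mis-clustered.\<close>
  have one_le: "1 \<le> (\<Prod>\<omega>\<in>?U. ennreal (g \<omega> (X s \<omega>)))" if "mis_clustered d P z (X s)" for s
  proof -
    have g_exp: "g \<omega> k = exp ((P z \<omega> - P z' \<omega> - k * ln (P z \<omega> / P z' \<omega>)) / 2)"
      if "\<omega> \<in> ?U" for \<omega> k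
    proof -
      have "sqrt (P z' \<omega> / P z \<omega>) = exp (ln (sqrt (P z' \<omega> / P z \<omega>)))"
        using pos[OF that] by simp
      also have "\<dots> = exp (- ln (P z \<omega> / P z' \<omega>) / 2)"
        using pos[OF that] by (simp add: ln_sqrt ln_div del: real_sqrt_divide exp_ln)
      finally have "sqrt (P z' \<omega> / P z \<omega>) = exp (- ln (P z \<omega> / P z' \<omega>) / 2)" .
      then show ?thesis
        by (simp add: g_def field_simps flip: exp_of_nat_mult exp_add)
    qed
    have "0 \<le> (\<Sum>\<omega>\<in>?U. (P z \<omega> - P z' \<omega> - X s \<omega> * ln (P z \<omega> / P z' \<omega>)) / 2)"
      using that mis_clustered_iff[OF assms(2-4)]
      by (simp add: sum_subtractf flip: sum_divide_distrib)
    then have "1 \<le> (\<Prod>\<omega>\<in>?U. g \<omega> (X s \<omega>))"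
      by (simp add: g_exp finite_upper_pairs flip: exp_sum)
    then show ?thesis
      by (simp add: prod_ennreal g_nonneg)
  qed
  have meas: "(\<lambda>s. \<Prod>\<omega>\<in>?U. ennreal (g \<omega> (X s \<omega>))) \<in> borel_measurable M"
    using g_meas by (rule borel_measurable_prod_ennreal)
  \<comment> \<open>\<open>emeasure_mono\<close> asks for measurability of the larger event only,
    and \<open>meas\<close> provides it.\<close>
  have "emeasure M {s \<in> space M. mis_clustered d P z (X s)}
      \<le> emeasure M {s \<in> space M. 1 \<le> (\<Prod>\<omega>\<in>?U. ennreal (g \<omega> (X s \<omega>)))}"
    using meas by (intro emeasure_mono) (auto intro: one_le)
  \<comment> \<open>Markov's inequality at threshold 1, over the whole space.\<close>
  also have "\<dots> \<le> (\<integral>\<^sup>+s. (\<Prod>\<omega>\<in>?U. ennreal (g \<omega> (X s \<omega>))) \<partial>M)"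
    using nn_integral_Markov_inequality[OF borel_measurable_times_ennreal[OF meas] sets.top, of 1]
    by (simp cong: nn_integral_cong)
  \<comment> \<open>Independence of the entries turns the integral of the product into a product of
    integrals, one for each entry.\<close>
  also have "\<dots> = (\<Prod>\<omega>\<in>?U. \<integral>\<^sup>+s. ennreal (g \<omega> (X s \<omega>)) \<partial>M)"
    by (intro indep_vars_nn_integral finite_upper_pairs indep_vars_compose2[OF indep]) auto
  also have "\<dots> = (\<Prod>\<omega>\<in>?U. ennreal (exp (- (sqrt (P z \<omega>) - sqrt (P z' \<omega>))\<^sup>2 / 2)))"
  proof (rule prod.cong)
    fix \<omega> assume \<omega>: "\<omega> \<in> ?U"
    \<comment> \<open>Each factor depends on \<open>s\<close> only through one entry, so it can be
      integrated against the Poisson law of that entry.\<close>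
    have "(\<integral>\<^sup>+s. ennreal (g \<omega> (X s \<omega>)) \<partial>M) =
        (\<integral>\<^sup>+k. ennreal (g \<omega> k) \<partial>distr M (count_space UNIV) (\<lambda>s. X s \<omega>))"
      using rv[OF \<omega>] by (subst nn_integral_distr) auto
    then show "(\<integral>\<^sup>+s. ennreal (g \<omega> (X s \<omega>)) \<partial>M) =
        ennreal (exp (- (sqrt (P z \<omega>) - sqrt (P z' \<omega>))\<^sup>2 / 2))"
      using poisson_affinity[OF pos[OF \<omega>]] by (simp only: law[OF \<omega>] g_def)
  qed simp
  also have "\<dots> = ennreal (exp (- separation d (P z) (P z') / 2))"
    by (simp add: prod_ennreal separation_def finite_upper_pairs sum_divide_distrib
        flip: exp_sum sum_negf)
  finally show ?thesis
    by (simp add: emeasure_eq_measure)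
qed

theorem lemma3:
  fixes M :: "'a measure" and d :: nat and P :: "nat \<Rightarrow> nat \<times> nat \<Rightarrow> real"
    and X :: "'a \<Rightarrow> nat \<times> nat \<Rightarrow> nat"
  assumes "prob_space M"
    and "intensity_matrix d (P 1)" and "intensity_matrix d (P 2)"
  shows "(sampled_from M d (P 1) X \<longrightarrow>
           measure M {s \<in> space M. mis_clustered d P 1 (X s)}
             \<le> exp (- separation d (P 1) (P 2) / 2)) \<and>
         (sampled_from M d (P 2) X \<longrightarrow>
           measure M {s \<in> space M. mis_clustered d P 2 (X s)}
             \<le> exp (- separation d (P 1) (P 2) / 2))"
  \<comment> \<open>The second instance yields the separation with its arguments exchanged, hence
    the appeal to symmetry.\<close>
  using mis_clustered_bound[OF assms, of 1 2 X] mis_clustered_bound[OF assms, of 2 1 X]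
  by (simp add: separation_commute[of d "P 2"])

end
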